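(* Let $L$ be a complete orthomodular lattice with center $Z_F(L)$, and let $M$ be a complete boolean subalgebra of $L$ contained in $Z_F(L)$. Then the map $j_M:L\to L$ defined by $j_M(a)=\bigwedge\{x\in M\mid a\le x\}$ satisfies the Borceux-Van den Bossche conditions, and therefore $L$ is an idempotent, right-sided quantale with the binary operation $\&$ given by $a\,\&\,b=a\wedge j_M(b)$ for all $a,b\in L$.
   Context: A complete orthomodular lattice is a complete lattice $L$ (least element $0$, greatest element $1$) with a unary operation $\perp:L\to L$ such that, for all $a,b,a_i\in L$ and any index set $I$: $a^{\perp\perp}=a$; $(\bigvee_{i\in I}a_i)^\perp=\bigwedge_{i\in I}a_i^\perp$; $a\vee a^\perp=1$; $a\wedge a^\perp=0$; and if $a\le b$ then $b=a\vee(a^\perp\wedge b)$. For $a,b\in L$ put $a\,\&^F b=(a\vee b^\perp)\wedge b$. The center of $L$ is $Z_F(L)=\{a\in L\mid a\,\&^F b=b\,\&^F a=a\wedge b \text{ for all } b\in L\}$. A complete boolean subalgebra of $L$ is a subset of $L$ that is closed under arbitrary joins and meets (computed in $L$, including the empty ones) and under $\perp$, and that is a boolean algebra under the inherited operations. A map (called an "endomorphism" in this setting; it is not required to be a lattice homomorphism) $j:L\to L$ satisfies the Borceux-Van den Bossche conditions if it is a closure operation (order preserving, $a\le j(a)$, $j(j(a))=j(a)$) and, for all $a,b,a_i,b_i\in L$ and every index set $I$ (possibly empty): 1. $a\le j(a)$; 2. $j(a\wedge j(b))=j(a)\wedge j(b)$; 3. $a\wedge j(\bigvee_{i\in I}b_i)=\bigvee_{i\in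 I}(a\wedge j(b_i))$; 4. $(\bigvee_{i\in I}a_i)\wedge j(b)=\bigvee_{i\in I}(a_i\wedge j(b))$. A quantale is a lattice $Q$ having arbitrary joins together with an associative binary operation $\&$ such that $a\,\&\,(\bigvee_{i\in I}b_i)=\bigvee_{i\in I}(a\,\&\,b_i)$ and $(\bigvee_{i\in I}a_i)\,\&\,b=\bigvee_{i\in I}(a_i\,\&\,b)$ for all $a,b,a_i,b_i\in Q$. It is idempotent and right-sided if $a\,\&\,1=a$ and $a\,\&\,a=a$ for all $a\in Q$. *)

theory Defs
  imports "HOL-Library.Complemented_Lattices"
begin

unbundle lattice_syntax

text \<open>
  Complete orthomodular lattices are the library class \<^class>\<open>complete_orthomodular_lattice\<close>,
  with \<^const>\<open>uminus\<close> as the orthocomplementation. The class asks for an antitone involution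
  instead of the infinite De Morgan law; the law follows.
\<close>

lemma uminus_Sup_ortho:
  fixes A :: "'a::complete_orthomodular_lattice set"
  shows "- \<Squnion>A = \<Sqinter>(uminus ` A)"
proof (rule antisym)
  show "- \<Squnion>A \<le> \<Sqinter>(uminus ` A)"
    by (auto intro!: INF_greatest ortho_antimono Sup_upper)
  have "\<Squnion>A \<le> - \<Sqinter>(uminus ` A)"
    by (rule Sup_least, rule compl_le_swap1) (auto intro: INF_lower)
  then show "\<Sqinter>(uminus ` A) \<le> - \<Squnion>A"
    by (rule compl_le_swap1)
qed

definition sasaki :: "'a::orthomodular_lattice \<Rightarrow> 'a \<Rightarrow> 'a"  (infixl "&\<^sup>F" 70)
  where "a &\<^sup>F b = (a \<squnion> - b) \<sqinter> b"

definition center :: "'a::orthomodular_lattice set"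
  where "center = {a. \<forall>b. a &\<^sup>F b = b &\<^sup>F a \<and> b &\<^sup>F a = a \<sqinter> b}"

text \<open>
  A subset closed under the operations inherits every lattice law of the ambient lattice and
  the complement laws \<open>x \<sqinter> - x = \<bottom>\<close>, \<open>x \<squnion> - x = \<top>\<close>; being a boolean algebra therefore only
  adds distributivity. Taking \<open>X = {}\<close> puts \<open>\<bottom>\<close> and \<open>\<top>\<close> into \<open>M\<close>.
\<close>

locale complete_boolean_subalgebra =
  fixes M :: "'a::complete_orthomodular_lattice set"
  assumes Sup_closed: "X \<subseteq> M \<Longrightarrow> \<Squnion>X \<in> M"
    and Inf_closed: "X \<subseteq> M \<Longrightarrow> \<Sqinter>X \<in> M"
    and compl_closed: "x \<in> M \<Longrightarrow> - x \<in> M"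
    and inf_sup_distrib:
      "\<lbrakk>x \<in> M; y \<in> M; z \<in> M\<rbrakk> \<Longrightarrow> x \<sqinter> (y \<squnion> z) = (x \<sqinter> y) \<squnion> (x \<sqinter> z)"
    and sup_inf_distrib:
      "\<lbrakk>x \<in> M; y \<in> M; z \<in> M\<rbrakk> \<Longrightarrow> x \<squnion> (y \<sqinter> z) = (x \<squnion> y) \<sqinter> (x \<squnion> z)"

locale closure_operation =
  fixes j :: "'a::order \<Rightarrow> 'a"
  assumes mono: "a \<le> b \<Longrightarrow> j a \<le> j b"
    and extensive: "a \<le> j a"
    and idem: "j (j a) = j a"

text \<open>
  Joins of families \<open>(b\<^sub>i)\<^sub>i\<^sub>\<in>\<^sub>I\<close> are stated as joins of sets \<open>B\<close> of elements (possibly empty),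
  both sides depending only on the range of the family. The forms for families over an
  arbitrary index type are derived below.
\<close>

locale borceux_van_den_bossche = closure_operation j
  for j :: "'a::complete_lattice \<Rightarrow> 'a" +
  assumes inf_closure: "j (a \<sqinter> j b) = j a \<sqinter> j b"
    and inf_closure_Sup: "a \<sqinter> j (\<Squnion>B) = (\<Squnion>b\<in>B. a \<sqinter> j b)"
    and Sup_inf_closure: "\<Squnion>A \<sqinter> j b = (\<Squnion>a\<in>A. a \<sqinter> j b)"
begin

lemma inf_closure_SUP: "a \<sqinter> j (\<Squnion>i\<in>I. f i) = (\<Squnion>i\<in>I. a \<sqinter> j (f i))"
  using inf_closure_Sup[of a "f ` I"] by (simp add: image_image)

lemma SUP_inf_closure: "(\<Squnion>i\<in>I. f i) \<sqinter> j b = (\<Squnion>i\<in>I. f i \<sqinter> j b)"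
  using Sup_inf_closure[of "f ` I" b] by (simp add: image_image)

end

locale quantale = semigroup amp
  for amp :: "'a::complete_lattice \<Rightarrow> 'a \<Rightarrow> 'a" +
  assumes Sup_distrib_left: "amp a (\<Squnion>B) = (\<Squnion>b\<in>B. amp a b)"
    and Sup_distrib_right: "amp (\<Squnion>A) b = (\<Squnion>a\<in>A. amp a b)"
begin

lemma SUP_distrib_left: "amp a (\<Squnion>i\<in>I. f i) = (\<Squnion>i\<in>I. amp a (f i))"
  using Sup_distrib_left[of a "f ` I"] by (simp add: image_image)

lemma SUP_distrib_right: "amp (\<Squnion>i\<in>I. f i) b = (\<Squnion>i\<in>I. amp (f i) b)"
  using Sup_distrib_right[of "f ` I" b] by (simp add: image_image)

end

locale idempotent_right_sided_quantale = quantale amp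
  for amp :: "'a::complete_lattice \<Rightarrow> 'a \<Rightarrow> 'a" +
  assumes right_sided: "amp a \<top> = a"
    and idempotent: "amp a a = a"

definition closure_by :: "'a::complete_lattice set \<Rightarrow> 'a \<Rightarrow> 'a"
  where "closure_by M a = \<Sqinter>{x \<in> M. a \<le> x}"

end

theory Submission
  imports Defs
begin

text \<open>
  A central element \<open>z\<close> whose complement is central cuts every \<open>x\<close> into \<open>(z \<sqinter> x) \<squnion> (- z \<sqinter> x)\<close>,
  so meeting with \<open>z\<close> is left adjoint to joining with \<open>- z\<close>: \<open>x \<sqinter> z \<le> y \<longleftrightarrow> x \<le> y \<squnion> - z\<close>. The
  elements of \<open>M\<close> are of this kind, and the values of \<open>closure_by M\<close> are the elements of \<open>M\<close>.
  Two of the Borceux-Van den Bossche conditions come from this adjunction: meeting with an element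
  of \<open>M\<close> preserves joins, because left adjoints do, and \<open>a \<sqinter> z\<close> has closure
  \<open>closure_by M a \<sqinter> z\<close>, because an upper bound \<open>x \<in> M\<close> of \<open>a \<sqinter> z\<close> is the same as an
  upper bound \<open>x \<squnion> - z \<in> M\<close> of \<open>a\<close>. The remaining one needs an arbitrary \<open>a\<close> to distribute over a
  join of elements of \<open>M\<close>. Here meeting with \<open>a\<close> has no adjoint, but each member \<open>z\<close> of the join,
  being central, is split by \<open>a\<close> as \<open>(z \<sqinter> a) \<squnion> (z \<sqinter> - a)\<close>, and orthomodularity suffices to
  remove the \<open>- a\<close> parts (\<open>inf_Sup_central\<close>).

  The quantale laws then follow for any map with the Borceux-Van den Bossche conditions, the
  condition on \<open>a \<sqinter> j b\<close> being associativity.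
\<close>

section \<open>Central elements of an orthomodular lattice\<close>

lemma center_sup_compl_inf:
  fixes z :: "'a::orthomodular_lattice"
  assumes "z \<in> center"
  shows "(b \<squnion> - z) \<sqinter> z = b \<sqinter> z" and "(z \<squnion> - b) \<sqinter> b = z \<sqinter> b"
  using assms by (auto simp: center_def sasaki_def inf_commute)

text \<open>
  Orthomodularity gives \<open>x = (z \<sqinter> x) \<squnion> ((- z \<squnion> - x) \<sqinter> x)\<close>, and centrality of \<open>- z\<close>
  simplifies the second part.
\<close>

lemma center_splits:
  fixes z :: "'a::orthomodular_lattice"
  assumes "- z \<in> center"
  shows "x = (z \<sqinter> x) \<squnion> (- z \<sqinter> x)"
proof -
  have "x = (z \<sqinter> x) \<squnion> (- (z \<sqinter> x) \<sqinter> x)"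
    using orthomodular[of "z \<sqinter> x" x] by (simp del: compl_inf)
  also have "- (z \<sqinter> x) \<sqinter> x = - z \<sqinter> x"
    using center_sup_compl_inf(2)[OF assms] by simp
  finally show ?thesis .
qed

lemma splits_center:
  fixes z :: "'a::orthomodular_lattice"
  assumes "z \<in> center"
  shows "z = (z \<sqinter> a) \<squnion> (z \<sqinter> - a)"
proof -
  have "z = (z \<sqinter> a) \<squnion> (- (z \<sqinter> a) \<sqinter> z)"
    using orthomodular[of "z \<sqinter> a" z] by (simp del: compl_inf)
  also have "- (z \<sqinter> a) \<sqinter> z = z \<sqinter> - a"
    using center_sup_compl_inf(1)[OF assms, of "- a"] by (simp add: sup_commute inf_commute)
  finally show ?thesis .
qed

lemma central_inf_le_iff:
  fixes z :: "'a::orthomodular_lattice"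
  assumes "z \<in> center" and "- z \<in> center"
  shows "x \<sqinter> z \<le> y \<longleftrightarrow> x \<le> y \<squnion> - z"
proof
  assume "x \<sqinter> z \<le> y"
  then have "(z \<sqinter> x) \<squnion> (- z \<sqinter> x) \<le> y \<squnion> - z"
    by (intro sup_mono) (auto simp: inf_commute)
  then show "x \<le> y \<squnion> - z"
    using center_splits[OF assms(2), of x] by simp
next
  assume "x \<le> y \<squnion> - z"
  then have "x \<sqinter> z \<le> (y \<squnion> - z) \<sqinter> z"
    by (rule inf_mono) simp
  then show "x \<sqinter> z \<le> y"
    by (simp add: center_sup_compl_inf(1)[OF assms(1)])
qed

lemma Sup_inf_central:
  fixes z :: "'a::complete_orthomodular_lattice"
  assumes "z \<in> center" and "- z \<in> center"
  shows "\<Squnion>A \<sqinter> z = (\<Squnion>a\<in>A. a \<sqinter> z)"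
proof (rule antisym)
  show "\<Squnion>A \<sqinter> z \<le> (\<Squnion>a\<in>A. a \<sqinter> z)"
    unfolding central_inf_le_iff[OF assms]
  proof (rule Sup_least)
    fix a assume "a \<in> A"
    then show "a \<le> (\<Squnion>a\<in>A. a \<sqinter> z) \<squnion> - z"
      unfolding central_inf_le_iff[OF assms, symmetric] by (rule SUP_upper)
  qed
  show "(\<Squnion>a\<in>A. a \<sqinter> z) \<le> \<Squnion>A \<sqinter> z"
    by (auto intro!: SUP_least intro: Sup_upper le_infI1)
qed

text \<open>
  With \<open>y\<close> the right-hand side, splitting each \<open>z \<in> Z\<close> along \<open>a\<close> bounds it by \<open>y \<squnion> - a\<close>.
  This bounds the whole join, and \<open>(y \<squnion> - a) \<sqinter> a = y\<close> by orthomodularity, since \<open>y \<le> a\<close>.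
\<close>

lemma inf_Sup_central:
  fixes Z :: "'a::complete_orthomodular_lattice set"
  assumes "Z \<subseteq> center"
  shows "a \<sqinter> \<Squnion>Z = (\<Squnion>z\<in>Z. a \<sqinter> z)"
proof (rule antisym)
  define y where "y = (\<Squnion>z\<in>Z. a \<sqinter> z)"
  have "y \<le> a"
    unfolding y_def by (rule SUP_least) simp
  have "\<Squnion>Z \<le> y \<squnion> - a"
  proof (rule Sup_least)
    fix z assume "z \<in> Z"
    then have "z \<sqinter> a \<le> y"
      unfolding y_def by (subst inf_commute) (rule SUP_upper)
    then have "(z \<sqinter> a) \<squnion> (z \<sqinter> - a) \<le> y \<squnion> - a"
      by (intro sup_mono) auto
    then show "z \<le> y \<squnion> - a"
      using splits_center[of z a] \<open>z \<in> Z\<close> assms by (metis subsetD)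
  qed
  then have "a \<sqinter> \<Squnion>Z \<le> a \<sqinter> (y \<squnion> - a)"
    by (rule inf_mono[OF order_refl])
  also have "\<dots> = y"
  proof -
    \<comment> \<open>The orthomodular law for \<open>- a \<le> - y\<close>, complemented.\<close>
    have "- a \<squnion> (a \<sqinter> - y) = - y"
      using orthomodular[of "- a" "- y"] \<open>y \<le> a\<close> by simp
    then have "- (- a \<squnion> (a \<sqinter> - y)) = - (- y)"
      by simp
    then show ?thesis
      by (simp add: sup_commute)
  qed
  finally show "a \<sqinter> \<Squnion>Z \<le> (\<Squnion>z\<in>Z. a \<sqinter> z)"
    unfolding y_def .
  show "(\<Squnion>z\<in>Z. a \<sqinter> z) \<le> a \<sqinter> \<Squnion>Z"
    by (auto intro!: SUP_least intro: Sup_upper le_infI2)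
qed

section \<open>The closure operation of a complete boolean subalgebra\<close>

lemma le_closure_by: "a \<le> closure_by M a"
  unfolding closure_by_def by (auto intro: Inf_greatest)

lemma closure_by_le: "x \<in> M \<Longrightarrow> a \<le> x \<Longrightarrow> closure_by M a \<le> x"
  unfolding closure_by_def by (auto intro: Inf_lower)

context complete_boolean_subalgebra
begin

lemma sup_closed: "x \<in> M \<Longrightarrow> y \<in> M \<Longrightarrow> x \<squnion> y \<in> M"
  using Sup_closed[of "{x, y}"] by simp

lemma inf_closed: "x \<in> M \<Longrightarrow> y \<in> M \<Longrightarrow> x \<sqinter> y \<in> M"
  using Inf_closed[of "{x, y}"] by simp

lemma closure_by_mem: "closure_by M a \<in> M"
  unfolding closure_by_def by (rule Inf_closed) auto

lemma closure_operation_closure_by: "closure_operation (closure_by M)"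
proof
  fix a b :: 'a
  show "a \<le> b \<Longrightarrow> closure_by M a \<le> closure_by M b"
    by (intro closure_by_le closure_by_mem order_trans[OF _ le_closure_by])
  show "a \<le> closure_by M a"
    by (rule le_closure_by)
  show "closure_by M (closure_by M a) = closure_by M a"
    by (intro antisym closure_by_le closure_by_mem le_closure_by order_refl)
qed

text \<open>
  A closure operation satisfies only \<open>\<ge>\<close> in general. Equality holds because \<open>M\<close> is closed under
  joins: the join of the closures is itself an upper bound of \<open>\<Squnion>B\<close> taken from \<open>M\<close>.
\<close>

lemma closure_by_Sup: "closure_by M (\<Squnion>B) = \<Squnion>(closure_by M ` B)"
proof (rule antisym)
  show "closure_by M (\<Squnion>B) \<le> \<Squnion>(closure_by M ` B)"
    by (intro closure_by_le Sup_closed Sup_least)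
      (auto intro: closure_by_mem SUP_upper2 le_closure_by)
  show "\<Squnion>(closure_by M ` B) \<le> closure_by M (\<Squnion>B)"
    by (auto intro!: SUP_least closure_operation.mono[OF closure_operation_closure_by] Sup_upper)
qed

lemma closure_by_inf_mem:
  assumes "M \<subseteq> center" and "z \<in> M"
  shows "closure_by M (a \<sqinter> z) = closure_by M a \<sqinter> z"
proof (rule antisym)
  have central: "z \<in> center" "- z \<in> center"
    using assms compl_closed by auto
  show "closure_by M (a \<sqinter> z) \<le> closure_by M a \<sqinter> z"
    by (intro closure_by_le inf_closed closure_by_mem assms(2) inf_mono le_closure_by order_refl)
  \<comment> \<open>Pass \<open>z\<close> across the adjunction, close \<open>a\<close>, and pass \<open>z\<close> back.\<close>
  have "a \<le> closure_by M (a \<sqinter> z) \<squnion> - z"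
    using le_closure_by[of "a \<sqinter> z" M] by (simp add: central_inf_le_iff[OF central])
  then have "closure_by M a \<le> closure_by M (a \<sqinter> z) \<squnion> - z"
    by (intro closure_by_le sup_closed closure_by_mem compl_closed assms(2))
  then show "closure_by M a \<sqinter> z \<le> closure_by M (a \<sqinter> z)"
    by (simp add: central_inf_le_iff[OF central])
qed

lemma borceux_van_den_bossche_closure_by:
  assumes "M \<subseteq> center"
  shows "borceux_van_den_bossche (closure_by M)"
proof (intro borceux_van_den_bossche.intro borceux_van_den_bossche_axioms.intro
    closure_operation_closure_by)
  fix a b :: 'a and A B :: "'a set"
  show "closure_by M (a \<sqinter> closure_by M b) = closure_by M a \<sqinter> closure_by M b"
    by (rule closure_by_inf_mem[OF assms closure_by_mem])
  have "closure_by M ` B \<subseteq> center"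
    using assms closure_by_mem by auto
  then show "a \<sqinter> closure_by M (\<Squnion>B) = (\<Squnion>b\<in>B. a \<sqinter> closure_by M b)"
    by (simp add: closure_by_Sup inf_Sup_central image_image)
  show "\<Squnion>A \<sqinter> closure_by M b = (\<Squnion>a\<in>A. a \<sqinter> closure_by M b)"
    using assms closure_by_mem compl_closed by (intro Sup_inf_central) auto
qed

end

section \<open>From the closure operation to the quantale\<close>

lemma (in borceux_van_den_bossche) idempotent_right_sided_quantale_inf_closure:
  "idempotent_right_sided_quantale (\<lambda>a b. a \<sqinter> j b)"
proof
  fix a b c :: 'a and A B :: "'a set"
  show "a \<sqinter> j b \<sqinter> j c = a \<sqinter> j (b \<sqinter> j c)"
    by (simp add: inf_closure inf_assoc)
  show "a \<sqinter> j (\<Squnion>B) = (\<Squnion>b\<in>B. a \<sqinter> j b)"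
    by (rule inf_closure_Sup)
  show "\<Squnion>A \<sqinter> j b = (\<Squnion>a\<in>A. a \<sqinter> j b)"
    by (rule Sup_inf_closure)
  show "a \<sqinter> j \<top> = a"
    using extensive[of \<top>] by (simp add: top_unique)
  show "a \<sqinter> j a = a"
    by (rule inf_absorb1[OF extensive])
qed

theorem proposition9:
  fixes M :: "'a::complete_orthomodular_lattice set"
  assumes "complete_boolean_subalgebra M"
    and "M \<subseteq> center"
  shows "borceux_van_den_bossche (closure_by M)
    \<and> idempotent_right_sided_quantale (\<lambda>a b. a \<sqinter> closure_by M b)"
  using complete_boolean_subalgebra.borceux_van_den_bossche_closure_by[OF assms]
    borceux_van_den_bossche.idempotent_right_sided_quantale_inf_closure
  by blast

end
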